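(* Let $\mathcal{B}$ be a uniformly convex Banach space with modulus of uniform convexity $u$. Fix $\varepsilon>0$, $x\in\mathcal{B}$ with $x\ne0$ and $\Vert x\Vert\le1$, $\eta$ with $0<\eta<\frac12u(\varepsilon)$, and an integer $\lambda\ge1$. Let $G$ be an amenable group which is countable discrete or locally compact second countable, acting strongly on $\mathcal{B}$ via a representation $\pi:G\to\mathcal{L}_1(\mathcal{B},\mathcal{B})$, and let $(F_n)$ be a Følner sequence for $G$ which is $\left(\lambda,\frac{\eta}{3\Vert x\Vert}\right)$-fast. Then the sequence $(A_nx)$, $A_nx=\frac{1}{|F_n|}\int_{F_n}\pi(g^{-1})x\,dg$, has at most $$\lambda\cdot\left\lfloor\frac{2\Vert x\Vert}{u(\varepsilon)-2\eta}\right\rfloor+\lambda$$ $\varepsilon$-fluctuations.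
   Context: Groups carry a (left) Haar measure, denoted $dg$ or $|\cdot|$ (counting measure if $G$ is countable discrete). Modulus of uniform convexity: a nondecreasing function $u:(0,\infty)\to(0,\infty)$ such that for all $x,y\in\mathcal{B}$ with $\Vert x\Vert\le\Vert y\Vert\le1$ and $\Vert x-y\Vert\ge\varepsilon$ one has $\Vert\frac12(x+y)\Vert<\Vert y\Vert-u(\varepsilon)$; $\mathcal{B}$ is uniformly convex if such a $u$ exists. Action: $\mathcal{L}_1(\mathcal{B},\mathcal{B})$ is the set of linear operators on $\mathcal{B}$ of operator norm $1$. $G$ acts strongly on $\mathcal{B}$ via $\pi:G\to\mathcal{L}_1(\mathcal{B},\mathcal{B})$ if $\pi(e)=\mathrm{id}$, $\pi(g)\pi(h)=\pi(gh)$ for all $g,h\in G$, and for every $x\in\mathcal{B}$ the map $g\mapsto\pi(g)x$ is strongly measurable, i.e. a pointwise norm-limit of simple measurable functions $G\to\mathcal{B}$ (automatic if $G$ is countable discrete). $\mathcal{B}$-valued integrals are Bochner integrals. Følner sequence: if $G$ is countable discrete, a sequence $(F_n)$ of nonempty finite subsets such that for every $\varepsilon>0$ and finite $K\subset G$ there is $N$ with $|F_n\Delta kF_n|<\varepsilon|F_n|$ for all $n\ge N$, $k\in K$. If $G$ is locally compact second countable (lcsc), a sequence $(F_n)$ of compact subsets of positive Haar measure such that for every $\varepsilon>0$ and compact $K\subset G$ there is $N$ such that for all $n\ge N$ there is a measurable $K'\subset K$ with $|K'|>(1-\varepsilon)|K|$ and $|F_n\Delta kF_n|<\varepsilon|F_n|$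 for all $k\in K'$. A group is amenable if it has a Følner sequence. Fast Følner sequence: $(F_n)$ is $(\lambda,\delta)$-fast if for all indices $k$ and all $m\ge k+\lambda$: (countable discrete case) $|F_m\Delta gF_m|/|F_m|<\delta$ for all $g\in F_k$; (lcsc case) there is a measurable $F_k'\subset F_k$ with $|F_k\setminus F_k'|<\delta|F_k|$ such that $|F_m\Delta gF_m|/|F_m|<\delta$ for all $g\in F_k'$. Fluctuations: a sequence $(x_n)$ has at most $M$ $\varepsilon$-fluctuations if, whenever $n_0<n_1<\dots<n_k$ are indices with $\Vert x_{n_i}-x_{n_{i+1}}\Vert\ge\varepsilon$ for all $0\le i<k$, one has $k\le M$. *)

theory Defs
  imports "HOL-Analysis.Analysis" "HOL-Algebra.Coset"
begin

definition modulus_of_uniform_convexity :: "'b::real_normed_vector itself \<Rightarrow> (real \<Rightarrow> real) \<Rightarrow> bool"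
  where "modulus_of_uniform_convexity _ u \<longleftrightarrow>
    mono_on {0<..} u \<and> (\<forall>\<epsilon>>0. u \<epsilon> > 0) \<and>
    (\<forall>\<epsilon>>0. \<forall>x y :: 'b. norm x \<le> norm y \<and> norm y \<le> 1 \<and> norm (x - y) \<ge> \<epsilon> \<longrightarrow>
      norm ((1/2) *\<^sub>R (x + y)) < norm y - u \<epsilon>)"

text \<open>
  The integral \<^const>\<open>lebesgue_integral\<close> is restricted to second countable (that is, separable)
  Banach spaces. The following definitions repeat its construction for arbitrary Banach spaces,
  with strong measurability in place of Borel measurability.
\<close>

definition strongly_measurable :: "'a measure \<Rightarrow> ('a \<Rightarrow> 'b::real_normed_vector) \<Rightarrow> bool"
  where "strongly_measurable M f \<longleftrightarrow>
    (\<exists>s :: nat \<Rightarrow> 'a \<Rightarrow> 'b. (\<forall>i. simple_function M (s i)) \<and>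
      (\<forall>x\<in>space M. (\<lambda>i. s i x) \<longlonglongrightarrow> f x))"

definition has_strong_integral :: "'a measure \<Rightarrow> ('a \<Rightarrow> 'b::real_normed_vector) \<Rightarrow> 'b \<Rightarrow> bool"
  where "has_strong_integral M f I \<longleftrightarrow>
    strongly_measurable M f \<and>
    (\<exists>s :: nat \<Rightarrow> 'a \<Rightarrow> 'b. (\<forall>i. Bochner_Integration.simple_bochner_integrable M (s i)) \<and>
      (\<lambda>i. \<integral>\<^sup>+x. norm (f x - s i x) \<partial>M) \<longlonglongrightarrow> 0 \<and>
      (\<lambda>i. Bochner_Integration.simple_bochner_integral M (s i)) \<longlonglongrightarrow> I)"

definition strong_integral :: "'a measure \<Rightarrow> ('a \<Rightarrow> 'b::real_normed_vector) \<Rightarrow> 'b"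
  where "strong_integral M f =
    (if \<exists>I. has_strong_integral M f I then THE I. has_strong_integral M f I else 0)"

lemma strongly_measurable_iff_borel_measurable:
  fixes f :: "'a \<Rightarrow> 'b::{real_normed_vector, second_countable_topology}"
  shows "strongly_measurable M f \<longleftrightarrow> f \<in> borel_measurable M"
proof
  assume "strongly_measurable M f"
  then obtain s where s: "\<And>i. simple_function M (s i)"
    "\<And>x. x \<in> space M \<Longrightarrow> (\<lambda>i. s i x) \<longlonglongrightarrow> f x"
    unfolding strongly_measurable_def by blast
  show "f \<in> borel_measurable M"
    by (rule borel_measurable_LIMSEQ_metric[OF borel_measurable_simple_function[OF s(1)] s(2)])
next
  assume "f \<in> borel_measurable M"
  then show "strongly_measurable M f"
    unfolding strongly_measurable_def
    using borel_measurable_implies_sequence_metric[of f M 0] by blast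
qed

lemma has_strong_integral_iff_has_bochner_integral:
  fixes f :: "'a \<Rightarrow> 'b::{real_normed_vector, second_countable_topology}"
  shows "has_strong_integral M f I \<longleftrightarrow> has_bochner_integral M f I"
  unfolding has_strong_integral_def has_bochner_integral.simps
    strongly_measurable_iff_borel_measurable by blast

lemma strong_integral_eq_lebesgue_integral:
  fixes f :: "'a \<Rightarrow> 'b::{banach, second_countable_topology}"
  shows "strong_integral M f = lebesgue_integral M f"
  unfolding strong_integral_def lebesgue_integral_def
    has_strong_integral_iff_has_bochner_integral ..

definition countable_discrete_group :: "('g, 'm) monoid_scheme \<Rightarrow> 'g topology \<Rightarrow> bool"
  where "countable_discrete_group G T \<longleftrightarrow>
    group G \<and> countable (carrier G) \<and> T = discrete_topology (carrier G)"

definition lcsc_group :: "('g, 'm) monoid_scheme \<Rightarrow> 'g topology \<Rightarrow> bool"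
  where "lcsc_group G T \<longleftrightarrow>
    group G \<and> topspace T = carrier G \<and>
    continuous_map (prod_topology T T) T (\<lambda>(g, h). g \<otimes>\<^bsub>G\<^esub> h) \<and>
    continuous_map T T (\<lambda>g. inv\<^bsub>G\<^esub> g) \<and>
    Hausdorff_space T \<and> locally_compact_space T \<and> second_countable T"

text \<open>
  The fourth and fifth conditions (outer and inner regularity) are part of the usual definition of
  a Radon measure; they hold automatically when \<open>T\<close> is locally compact, Hausdorff and second
  countable.
\<close>

definition left_haar_measure :: "('g, 'm) monoid_scheme \<Rightarrow> 'g topology \<Rightarrow> 'g measure \<Rightarrow> bool"
  where "left_haar_measure G T \<mu> \<longleftrightarrow>
    sets \<mu> = sets (sigma (topspace T) {U. openin T U}) \<and>
    emeasure \<mu> (carrier G) \<noteq> 0 \<and>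
    (\<forall>K. compactin T K \<longrightarrow> emeasure \<mu> K < \<infinity>) \<and>
    (\<forall>A\<in>sets \<mu>. emeasure \<mu> A = (INF U\<in>{U. openin T U \<and> A \<subseteq> U}. emeasure \<mu> U)) \<and>
    (\<forall>U. openin T U \<longrightarrow> emeasure \<mu> U = (SUP K\<in>{K. compactin T K \<and> K \<subseteq> U}. emeasure \<mu> K)) \<and>
    (\<forall>g\<in>carrier G. \<forall>A\<in>sets \<mu>. emeasure \<mu> (g <#\<^bsub>G\<^esub> A) = emeasure \<mu> A)"

definition acts_strongly ::
    "('g, 'm) monoid_scheme \<Rightarrow> 'g measure \<Rightarrow> ('g \<Rightarrow> 'b::real_normed_vector \<Rightarrow>\<^sub>L 'b) \<Rightarrow> bool"
  where "acts_strongly G \<mu> \<pi> \<longleftrightarrow>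
    (\<forall>g\<in>carrier G. norm (\<pi> g) = 1) \<and>
    \<pi> \<one>\<^bsub>G\<^esub> = id_blinfun \<and>
    (\<forall>g\<in>carrier G. \<forall>h\<in>carrier G. \<pi> g o\<^sub>L \<pi> h = \<pi> (g \<otimes>\<^bsub>G\<^esub> h)) \<and>
    (\<forall>x. strongly_measurable \<mu> (\<lambda>g. \<pi> g x))"

definition folner_discrete :: "('g, 'm) monoid_scheme \<Rightarrow> (nat \<Rightarrow> 'g set) \<Rightarrow> bool"
  where "folner_discrete G F \<longleftrightarrow>
    (\<forall>n. finite (F n) \<and> F n \<noteq> {} \<and> F n \<subseteq> carrier G) \<and>
    (\<forall>\<epsilon>>0. \<forall>K. finite K \<and> K \<subseteq> carrier G \<longrightarrow>
      (\<exists>N. \<forall>n\<ge>N. \<forall>k\<in>K.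
        real (card (sym_diff (F n) (k <#\<^bsub>G\<^esub> F n))) < \<epsilon> * real (card (F n))))"

text \<open>
  The compact sets \<open>K\<close> below have positive measure: for a null set \<open>K\<close> no subset \<open>K'\<close> satisfies
  the strict inequality \<open>|K'| > (1 - \<epsilon>) |K|\<close>.
\<close>

definition folner_lcsc ::
    "('g, 'm) monoid_scheme \<Rightarrow> 'g topology \<Rightarrow> 'g measure \<Rightarrow> (nat \<Rightarrow> 'g set) \<Rightarrow> bool"
  where "folner_lcsc G T \<mu> F \<longleftrightarrow>
    (\<forall>n. compactin T (F n) \<and> measure \<mu> (F n) > 0) \<and>
    (\<forall>\<epsilon>>0. \<forall>K. compactin T K \<and> measure \<mu> K > 0 \<longrightarrow>
      (\<exists>N. \<forall>n\<ge>N. \<exists>K'\<in>sets \<mu>. K' \<subseteq> K \<and> measure \<mu> K' > (1 - \<epsilon>) * measure \<mu> K \<and>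
        (\<forall>k\<in>K'. measure \<mu> (sym_diff (F n) (k <#\<^bsub>G\<^esub> F n)) < \<epsilon> * measure \<mu> (F n))))"

definition amenable_discrete :: "('g, 'm) monoid_scheme \<Rightarrow> bool"
  where "amenable_discrete G \<longleftrightarrow> (\<exists>F. folner_discrete G F)"

definition amenable_lcsc :: "('g, 'm) monoid_scheme \<Rightarrow> 'g topology \<Rightarrow> 'g measure \<Rightarrow> bool"
  where "amenable_lcsc G T \<mu> \<longleftrightarrow> (\<exists>F. folner_lcsc G T \<mu> F)"

definition fast_discrete ::
    "('g, 'm) monoid_scheme \<Rightarrow> nat \<Rightarrow> real \<Rightarrow> (nat \<Rightarrow> 'g set) \<Rightarrow> bool"
  where "fast_discrete G l \<delta> F \<longleftrightarrow>
    (\<forall>k. \<forall>m\<ge>k + l. \<forall>g\<in>F k.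
      real (card (sym_diff (F m) (g <#\<^bsub>G\<^esub> F m))) / real (card (F m)) < \<delta>)"

definition fast_lcsc ::
    "('g, 'm) monoid_scheme \<Rightarrow> 'g measure \<Rightarrow> nat \<Rightarrow> real \<Rightarrow> (nat \<Rightarrow> 'g set) \<Rightarrow> bool"
  where "fast_lcsc G \<mu> l \<delta> F \<longleftrightarrow>
    (\<forall>k. \<forall>m\<ge>k + l. \<exists>F'\<in>sets \<mu>. F' \<subseteq> F k \<and> measure \<mu> (F k - F') < \<delta> * measure \<mu> (F k) \<and>
      (\<forall>g\<in>F'. measure \<mu> (sym_diff (F m) (g <#\<^bsub>G\<^esub> F m)) / measure \<mu> (F m) < \<delta>))"

definition ergodic_average ::
    "('g, 'm) monoid_scheme \<Rightarrow> 'g measure \<Rightarrow> ('g \<Rightarrow> 'b::real_normed_vector \<Rightarrow>\<^sub>L 'b) \<Rightarrow>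
      (nat \<Rightarrow> 'g set) \<Rightarrow> nat \<Rightarrow> 'b \<Rightarrow> 'b"
  where "ergodic_average G \<mu> \<pi> F n x =
    (1 / measure \<mu> (F n)) *\<^sub>R
      strong_integral \<mu> (\<lambda>g. indicat_real (F n) g *\<^sub>R \<pi> (inv\<^bsub>G\<^esub> g) x)"

definition at_most_fluctuations :: "nat \<Rightarrow> real \<Rightarrow> (nat \<Rightarrow> 'b::real_normed_vector) \<Rightarrow> bool"
  where "at_most_fluctuations M \<epsilon> X \<longleftrightarrow>
    (\<forall>k. \<forall>n :: nat \<Rightarrow> nat. strict_mono_on {0..k} n \<and>
      (\<forall>i<k. norm (X (n i) - X (n (Suc i))) \<ge> \<epsilon>) \<longrightarrow> k \<le> M)"

end

theory Submission
  imports Defs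
begin

text \<open>
  Write \<open>A\<^sub>m\<close> for the averaging operators. Left invariance gives \<open>\<parallel>A\<^sub>m \<pi>(h\<inverse>) x - A\<^sub>m x\<parallel> \<le>
  |F\<^sub>m \<triangle> h F\<^sub>m| / |F\<^sub>m| \<cdot> \<parallel>x\<parallel>\<close>; since \<open>A\<^sub>m\<close> is a bounded operator and so commutes with the integral
  (no Fubini theorem is needed), averaging over \<open>h \<in> F\<^sub>k\<close> yields \<open>\<parallel>A\<^sub>m A\<^sub>k x - A\<^sub>m x\<parallel> \<le> \<eta>\<close> for
  \<open>m \<ge> k + \<lambda>\<close>. If \<open>\<parallel>A\<^sub>p x - A\<^sub>q x\<parallel> \<ge> \<epsilon>\<close> and \<open>m \<ge> p + \<lambda>, q + \<lambda>\<close>, then \<open>A\<^sub>m x\<close> is \<open>\<eta>\<close>-close to the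
  image under \<open>A\<^sub>m\<close> of the midpoint of \<open>A\<^sub>p x\<close> and \<open>A\<^sub>q x\<close>, so by uniform convexity its norm is less
  than \<open>max \<parallel>A\<^sub>p x\<parallel> \<parallel>A\<^sub>q x\<parallel> - (u \<epsilon> - \<eta>)\<close>. Hence along a sequence of fluctuations the norm drops by
  \<open>u \<epsilon> - \<eta>\<close> every \<open>\<lambda> + 1\<close> steps. There are thus at most \<open>(\<lambda> + 1) \<lfloor>\<parallel>x\<parallel> / (u \<epsilon> - \<eta>)\<rfloor> + \<lambda>\<close> of them,
  and \<open>\<lambda> + 1 \<le> 2 \<lambda>\<close>.
\<close>

section \<open>The integral of strongly measurable functions\<close>

lemma strongly_measurable_simple_function:
  "simple_function M f \<Longrightarrow> strongly_measurable M f"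
  unfolding strongly_measurable_def by (rule exI[of _ "\<lambda>_. f"]) auto

text \<open>Applying \<open>p\<close> to two simple functions gives a simple function, and
  continuity of \<open>p\<close> carries the pointwise limit over. Sums, differences, bounded linear
  images and products with indicators are all instances.\<close>

lemma strongly_measurable_continuous_compose2:
  assumes "strongly_measurable M f" "strongly_measurable M g"
    and p: "continuous_on UNIV (\<lambda>z. p (fst z) (snd z))"
  shows "strongly_measurable M (\<lambda>x. p (f x) (g x))"
proof -
  obtain s t where s: "\<And>i. simple_function M (s i)" "\<And>x. x \<in> space M \<Longrightarrow> (\<lambda>i. s i x) \<longlonglongrightarrow> f x"
    and t: "\<And>i. simple_function M (t i)" "\<And>x. x \<in> space M \<Longrightarrow> (\<lambda>i. t i x) \<longlonglongrightarrow> g x"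
    using assms unfolding strongly_measurable_def by metis
  have "(\<lambda>i. p (s i x) (t i x)) \<longlonglongrightarrow> p (f x) (g x)" if "x \<in> space M" for x
    using continuous_on_tendsto_compose[OF p tendsto_Pair[OF s(2) t(2)], OF that that] by simp
  then show ?thesis
    unfolding strongly_measurable_def
    by (intro exI[of _ "\<lambda>i x. p (s i x) (t i x)"]) (auto intro: simple_function_compose2 s t)
qed

lemma strongly_measurable_add:
  "strongly_measurable M f \<Longrightarrow> strongly_measurable M g \<Longrightarrow> strongly_measurable M (\<lambda>x. f x + g x)"
  by (rule strongly_measurable_continuous_compose2) (auto intro!: continuous_intros)

lemma strongly_measurable_diff:
  "strongly_measurable M f \<Longrightarrow> strongly_measurable M g \<Longrightarrow> strongly_measurable M (\<lambda>x. f x - g x)"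
  by (rule strongly_measurable_continuous_compose2) (auto intro!: continuous_intros)

lemma strongly_measurable_bounded_linear:
  assumes "bounded_linear T" "strongly_measurable M f"
  shows "strongly_measurable M (\<lambda>x. T (f x))"
  \<comment> \<open>The operator takes one argument only, so \<open>f\<close> fills the second slot
    as a dummy.\<close>
  using strongly_measurable_continuous_compose2[OF assms(2) assms(2), of "\<lambda>x y. T x"]
  by (simp add: bounded_linear.continuous_on[OF assms(1)] continuous_on_fst continuous_on_id)

lemma strongly_measurable_indicator_scaleR:
  assumes "A \<in> sets M" "strongly_measurable M f"
  shows "strongly_measurable M (\<lambda>x. indicat_real A x *\<^sub>R f x)"
  by (rule strongly_measurable_continuous_compose2)
    (auto intro!: continuous_intros strongly_measurable_simple_function assms)

lemma strongly_measurable_compose: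
  assumes "t \<in> measurable M N" "strongly_measurable N f"
  shows "strongly_measurable M (\<lambda>x. f (t x))"
proof -
  obtain s where s: "\<And>i. simple_function N (s i)" "\<And>x. x \<in> space N \<Longrightarrow> (\<lambda>i. s i x) \<longlonglongrightarrow> f x"
    using assms(2) unfolding strongly_measurable_def by metis
  then show ?thesis
    unfolding strongly_measurable_def
    by (intro exI[of _ "\<lambda>i x. s i (t x)"])
      (auto intro: simple_function_comp[OF assms(1)] measurable_space[OF assms(1)])
qed

lemma borel_measurable_norm_strongly_measurable:
  assumes "strongly_measurable M f"
  shows "(\<lambda>x. norm (f x)) \<in> borel_measurable M"
proof -
  obtain s where s: "\<And>i. simple_function M (s i)" "\<And>x. x \<in> space M \<Longrightarrow> (\<lambda>i. s i x) \<longlonglongrightarrow> f x"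
    using assms unfolding strongly_measurable_def by metis
  show ?thesis
    by (rule borel_measurable_LIMSEQ_metric[where f="\<lambda>i x. norm (s i x)"])
      (auto intro: borel_measurable_simple_function simple_function_compose1 s tendsto_norm)
qed

section \<open>Norm bound, linearity and uniqueness of the integral\<close>

lemma has_strong_integralE:
  assumes "has_strong_integral M f I"
  obtains s where "strongly_measurable M f"
    "\<And>i. Bochner_Integration.simple_bochner_integrable M (s i)"
    "\<And>i. (\<lambda>x. norm (f x - s i x)) \<in> borel_measurable M"
    "(\<lambda>i. \<integral>\<^sup>+x. norm (f x - s i x) \<partial>M) \<longlonglongrightarrow> 0"
    "(\<lambda>i. Bochner_Integration.simple_bochner_integral M (s i)) \<longlonglongrightarrow> I"
proof -
  obtain s where *: "strongly_measurable M f"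
    "\<And>i. Bochner_Integration.simple_bochner_integrable M (s i)"
    "(\<lambda>i. \<integral>\<^sup>+x. norm (f x - s i x) \<partial>M) \<longlonglongrightarrow> 0"
    "(\<lambda>i. Bochner_Integration.simple_bochner_integral M (s i)) \<longlonglongrightarrow> I"
    using assms unfolding has_strong_integral_def by auto
  have sf: "simple_function M (s i)" for i
    using *(2) by (rule simple_bochner_integrable.cases)
  \<comment> \<open>The definition does not list this measurability; it is derived once here because
    additivity of the nonnegative integral asks for it in every later estimate.\<close>
  have "(\<lambda>x. norm (f x - s i x)) \<in> borel_measurable M" for i
    by (intro borel_measurable_norm_strongly_measurable strongly_measurable_diff
        strongly_measurable_simple_function *(1) sf)
  with * show thesis by (intro that)
qed

lemma norm_simple_bochner_integral_le:
  fixes s :: "'a \<Rightarrow> 'b::real_normed_vector"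
  assumes s: "Bochner_Integration.simple_bochner_integrable M s"
  shows "ennreal (norm (Bochner_Integration.simple_bochner_integral M s)) \<le> (\<integral>\<^sup>+x. norm (s x) \<partial>M)"
proof -
  have "ennreal (norm (Bochner_Integration.simple_bochner_integral M s)) \<le>
      Bochner_Integration.simple_bochner_integral M (\<lambda>x. norm (s x))"
    by (auto intro!: simple_bochner_integral_norm_bound s)
  also have "\<dots> = (\<integral>\<^sup>+x. norm (s x) \<partial>M)"
    by (intro simple_bochner_integral_eq_nn_integral) (auto intro: s simple_bochner_integrable_compose2)
  finally show ?thesis .
qed

text \<open>Simple functions satisfy the bound. The norm of \<open>s i\<close> is at most the norm
  of \<open>f\<close> plus the approximation error, and the integral of that error vanishes in the
  limit.\<close>

lemma has_strong_integral_norm_bound: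
  assumes "has_strong_integral M f I"
  shows "norm I \<le> (\<integral>\<^sup>+x. norm (f x) \<partial>M)"
proof -
  obtain s where f: "strongly_measurable M f"
    and s: "\<And>i. Bochner_Integration.simple_bochner_integrable M (s i)"
    and [measurable]: "\<And>i. (\<lambda>x. norm (f x - s i x)) \<in> borel_measurable M"
    and lim: "(\<lambda>i. \<integral>\<^sup>+x. norm (f x - s i x) \<partial>M) \<longlonglongrightarrow> 0"
    and I: "(\<lambda>i. Bochner_Integration.simple_bochner_integral M (s i)) \<longlonglongrightarrow> I"
    by (rule has_strong_integralE[OF assms]) blast
  note [measurable] = borel_measurable_norm_strongly_measurable[OF f]
  show ?thesis
  proof (rule LIMSEQ_le)
    show "(\<lambda>i. ennreal (norm (Bochner_Integration.simple_bochner_integral M (s i)))) \<longlonglongrightarrow> norm I"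
      using I by (auto simp: tendsto_ennreal_iff intro: tendsto_intros)
    show "(\<lambda>i. (\<integral>\<^sup>+x. norm (f x - s i x) \<partial>M) + (\<integral>\<^sup>+x. norm (f x) \<partial>M))
        \<longlonglongrightarrow> (\<integral>\<^sup>+x. norm (f x) \<partial>M)"
      using tendsto_add[OF lim tendsto_const[of "\<integral>\<^sup>+x. norm (f x) \<partial>M"]] by simp
    have "ennreal (norm (Bochner_Integration.simple_bochner_integral M (s n))) \<le>
        (\<integral>\<^sup>+x. norm (f x - s n x) \<partial>M) + (\<integral>\<^sup>+x. norm (f x) \<partial>M)" for n
    proof -
      have "ennreal (norm (Bochner_Integration.simple_bochner_integral M (s n))) \<le>
          (\<integral>\<^sup>+x. norm (s n x) \<partial>M)"
        by (rule norm_simple_bochner_integral_le[OF s])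
      also have "\<dots> \<le> (\<integral>\<^sup>+x. ennreal (norm (f x - s n x)) + norm (f x) \<partial>M)"
        by (auto intro!: nn_integral_mono simp flip: ennreal_plus)
          (metis add.commute norm_minus_commute norm_triangle_sub)
      also have "\<dots> = (\<integral>\<^sup>+x. norm (f x - s n x) \<partial>M) + (\<integral>\<^sup>+x. norm (f x) \<partial>M)"
        by (rule nn_integral_add) auto
      finally show ?thesis .
    qed
    then show "\<exists>N. \<forall>n\<ge>N. ennreal (norm (Bochner_Integration.simple_bochner_integral M (s n))) \<le>
        (\<integral>\<^sup>+x. norm (f x - s n x) \<partial>M) + (\<integral>\<^sup>+x. norm (f x) \<partial>M)"
      by blast
  qed
qed

lemma has_strong_integral_add:
  assumes "has_strong_integral M f I" "has_strong_integral M g J"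
  shows "has_strong_integral M (\<lambda>x. f x + g x) (I + J)"
proof -
  obtain s where f: "strongly_measurable M f"
    and s: "\<And>i. Bochner_Integration.simple_bochner_integrable M (s i)"
    and [measurable]: "\<And>i. (\<lambda>x. norm (f x - s i x)) \<in> borel_measurable M"
    and slim: "(\<lambda>i. \<integral>\<^sup>+x. norm (f x - s i x) \<partial>M) \<longlonglongrightarrow> 0"
    and I: "(\<lambda>i. Bochner_Integration.simple_bochner_integral M (s i)) \<longlonglongrightarrow> I"
    by (rule has_strong_integralE[OF assms(1)]) blast
  obtain t where g: "strongly_measurable M g"
    and t: "\<And>i. Bochner_Integration.simple_bochner_integrable M (t i)"
    and [measurable]: "\<And>i. (\<lambda>x. norm (g x - t i x)) \<in> borel_measurable M"
    and tlim: "(\<lambda>i. \<integral>\<^sup>+x. norm (g x - t i x) \<partial>M) \<longlonglongrightarrow> 0"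
    and J: "(\<lambda>i. Bochner_Integration.simple_bochner_integral M (t i)) \<longlonglongrightarrow> J"
    by (rule has_strong_integralE[OF assms(2)]) blast
  have le: "(\<integral>\<^sup>+x. norm (f x + g x - (s i x + t i x)) \<partial>M) \<le>
      (\<integral>\<^sup>+x. norm (f x - s i x) \<partial>M) + (\<integral>\<^sup>+x. norm (g x - t i x) \<partial>M)" for i
  proof -
    have "(\<integral>\<^sup>+x. norm (f x + g x - (s i x + t i x)) \<partial>M) \<le>
        (\<integral>\<^sup>+x. ennreal (norm (f x - s i x)) + norm (g x - t i x) \<partial>M)"
      by (auto intro!: nn_integral_mono norm_diff_triangle_ineq simp flip: ennreal_plus)
    also have "\<dots> = (\<integral>\<^sup>+x. norm (f x - s i x) \<partial>M) + (\<integral>\<^sup>+x. norm (g x - t i x) \<partial>M)"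
      by (intro nn_integral_add) auto
    finally show ?thesis .
  qed
  have lim: "(\<lambda>i. \<integral>\<^sup>+x. norm (f x + g x - (s i x + t i x)) \<partial>M) \<longlonglongrightarrow> 0"
    by (rule tendsto_sandwich[of "\<lambda>_. 0", OF _ _ tendsto_const])
      (use le tendsto_add[OF slim tlim] in auto)
  show ?thesis
    unfolding has_strong_integral_def
    using tendsto_add[OF I J] lim
    by (intro conjI exI[of _ "\<lambda>i x. s i x + t i x"])
      (auto simp: simple_bochner_integral_add s t strongly_measurable_add f g
        intro: simple_bochner_integrable_compose2)
qed

text \<open>The functions \<open>T (s i x)\<close> approximate \<open>T (f x)\<close> with an error
  at most a constant times the old one. With an averaging operator as \<open>T\<close>, this moves
  one average under the integral that defines another.\<close>

lemma has_strong_integral_bounded_linear: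
  assumes "bounded_linear T" "has_strong_integral M f I"
  shows "has_strong_integral M (\<lambda>x. T (f x)) (T I)"
proof -
  interpret T: bounded_linear T by fact
  obtain s where f: "strongly_measurable M f"
    and s: "\<And>i. Bochner_Integration.simple_bochner_integrable M (s i)"
    and [measurable]: "\<And>i. (\<lambda>x. norm (f x - s i x)) \<in> borel_measurable M"
    and slim: "(\<lambda>i. \<integral>\<^sup>+x. norm (f x - s i x) \<partial>M) \<longlonglongrightarrow> 0"
    and I: "(\<lambda>i. Bochner_Integration.simple_bochner_integral M (s i)) \<longlonglongrightarrow> I"
    by (rule has_strong_integralE[OF assms(2)]) blast
  obtain K where K: "K > 0" "\<And>x i. norm (T (f x) - T (s i x)) \<le> norm (f x - s i x) * K"
    using T.pos_bounded by (auto simp: T.diff[symmetric])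
  have le: "(\<integral>\<^sup>+x. norm (T (f x) - T (s i x)) \<partial>M) \<le> K * (\<integral>\<^sup>+x. norm (f x - s i x) \<partial>M)" for i
  proof -
    have "(\<integral>\<^sup>+x. norm (T (f x) - T (s i x)) \<partial>M) \<le> (\<integral>\<^sup>+x. ennreal K * norm (f x - s i x) \<partial>M)"
      using K by (intro nn_integral_mono) (auto simp: ac_simps ennreal_mult[symmetric])
    also have "\<dots> = K * (\<integral>\<^sup>+x. norm (f x - s i x) \<partial>M)"
      by (intro nn_integral_cmult) auto
    finally show ?thesis .
  qed
  have lim: "(\<lambda>i. \<integral>\<^sup>+x. norm (T (f x) - T (s i x)) \<partial>M) \<longlonglongrightarrow> 0"
    by (rule tendsto_sandwich[of "\<lambda>_. 0", OF _ _ tendsto_const])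
      (use le ennreal_tendsto_cmult[OF _ slim, of "ennreal K"] in auto)
  show ?thesis
    unfolding has_strong_integral_def
    using T.tendsto[OF I] lim
    by (intro conjI exI[of _ "\<lambda>i x. T (s i x)"])
      (auto simp: simple_bochner_integral_linear T.linear_axioms s f
        strongly_measurable_bounded_linear[OF assms(1)]
        intro: simple_bochner_integrable_compose2[of "\<lambda>x _. T x", OF _ s s] T.zero)
qed

lemma has_strong_integral_diff:
  assumes "has_strong_integral M f I" "has_strong_integral M g J"
  shows "has_strong_integral M (\<lambda>x. f x - g x) (I - J)"
  using has_strong_integral_add[OF assms(1) has_strong_integral_bounded_linear[OF
      bounded_linear_minus[OF bounded_linear_ident] assms(2)]]
  by simp

text \<open>The difference \<open>I - J\<close> is an integral of the zero function, so the norm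
  bound makes it vanish.\<close>

lemma has_strong_integral_unique:
  assumes "has_strong_integral M f I" "has_strong_integral M f J"
  shows "I = J"
  using has_strong_integral_norm_bound[OF has_strong_integral_diff[OF assms]] by simp

lemma strong_integral_eqI:
  "has_strong_integral M f I \<Longrightarrow> strong_integral M f = I"
  unfolding strong_integral_def using has_strong_integral_unique by (auto intro!: the_equality)

lemma has_strong_integral_cong:
  assumes "\<And>x. x \<in> space M \<Longrightarrow> f x = g x"
  shows "has_strong_integral M f I \<longleftrightarrow> has_strong_integral M g I"
proof -
  have "(\<integral>\<^sup>+x. norm (f x - s x) \<partial>M) = (\<integral>\<^sup>+x. norm (g x - s x) \<partial>M)" for s
    by (intro nn_integral_cong) (simp add: assms)
  then show ?thesis
    unfolding has_strong_integral_def strongly_measurable_def by (simp add: assms)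
qed

section \<open>Measure-preserving substitutions and existence of the integral\<close>

lemma simple_bochner_integral_measure_preserving:
  assumes t: "t \<in> measurable M M" "distr M M t = M"
    and s: "Bochner_Integration.simple_bochner_integrable M s"
  shows "Bochner_Integration.simple_bochner_integrable M (\<lambda>x. s (t x))"
    and "Bochner_Integration.simple_bochner_integral M (\<lambda>x. s (t x)) =
      Bochner_Integration.simple_bochner_integral M s"
proof -
  have sf: "simple_function M s" and fin: "emeasure M {x \<in> space M. s x \<noteq> 0} \<noteq> \<infinity>"
    using s by (auto simp: simple_bochner_integrable.simps)
  have vimage: "t -` {x \<in> space M. P (s x)} \<inter> space M = {x \<in> space M. P (s (t x))}" for P
    using measurable_space[OF t(1)] by auto
  have sets: "{x \<in> space M. P (s x)} \<in> sets M" for P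
    using measurable_sets[OF measurable_simple_function[OF sf], of "Collect P"]
    by (simp add: vimage_def Int_def conj_commute)
  \<comment> \<open>Level sets of the composite are preimages under \<open>t\<close> of level sets
    of \<open>s\<close>, and \<open>t\<close> preserves the measure.\<close>
  have em: "emeasure M {x \<in> space M. P (s (t x))} = emeasure M {x \<in> space M. P (s x)}" for P
    using sets[of P] emeasure_distr[OF t(1), of "{x \<in> space M. P (s x)}"] unfolding t(2) vimage by simp
  show "Bochner_Integration.simple_bochner_integrable M (\<lambda>x. s (t x))"
    using simple_function_comp[OF t(1) sf] em[of "\<lambda>y. y \<noteq> 0"] fin
    by (intro simple_bochner_integrable.intros) auto
  \<comment> \<open>The composite may miss some values of \<open>s\<close>. The level set of a
    missed value has empty preimage, hence measure zero, so it adds nothing to the sum.\<close>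
  have "(\<Sum>y\<in>(\<lambda>x. s (t x)) ` space M. measure M {x \<in> space M. s x = y} *\<^sub>R y) =
      (\<Sum>y\<in>s ` space M. measure M {x \<in> space M. s x = y} *\<^sub>R y)"
  proof (intro sum.mono_neutral_left ballI)
    show "finite (s ` space M)"
      using sf by (auto simp: simple_function_def)
    show "(\<lambda>x. s (t x)) ` space M \<subseteq> s ` space M"
      using measurable_space[OF t(1)] by auto
    fix y assume "y \<in> s ` space M - (\<lambda>x. s (t x)) ` space M"
    then have "{x \<in> space M. s (t x) = y} = {}" by (auto simp: image_iff)
    then have "emeasure M {x \<in> space M. s x = y} = 0"
      using em[of "\<lambda>z. z = y"] by (metis emeasure_empty)
    then show "measure M {x \<in> space M. s x = y} *\<^sub>R y = 0"
      by (simp add: measure_def)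
  qed
  then show "Bochner_Integration.simple_bochner_integral M (\<lambda>x. s (t x)) =
      Bochner_Integration.simple_bochner_integral M s"
    unfolding simple_bochner_integral_def measure_def em[of "\<lambda>z. z = y" for y] .
qed

text \<open>Composing the approximating simple functions with \<open>t\<close> changes neither their
  errors, by change of variables, nor their integrals.\<close>

lemma has_strong_integral_measure_preserving:
  assumes t: "t \<in> measurable M M" "distr M M t = M" and f: "has_strong_integral M f I"
  shows "has_strong_integral M (\<lambda>x. f (t x)) I"
proof -
  obtain s where f: "strongly_measurable M f"
    and s: "\<And>i. Bochner_Integration.simple_bochner_integrable M (s i)"
    and m: "\<And>i. (\<lambda>x. norm (f x - s i x)) \<in> borel_measurable M"
    and lim: "(\<lambda>i. \<integral>\<^sup>+x. norm (f x - s i x) \<partial>M) \<longlonglongrightarrow> 0"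
    and I: "(\<lambda>i. Bochner_Integration.simple_bochner_integral M (s i)) \<longlonglongrightarrow> I"
    by (rule has_strong_integralE[OF f]) blast
  have "(\<integral>\<^sup>+x. norm (f (t x) - s i (t x)) \<partial>M) = (\<integral>\<^sup>+x. norm (f x - s i x) \<partial>M)" for i
    using nn_integral_distr[OF t(1), of "\<lambda>x. ennreal (norm (f x - s i x))"] m[of i]
    unfolding t(2) by simp
  then show ?thesis
    unfolding has_strong_integral_def
    using lim I simple_bochner_integral_measure_preserving[OF t s]
      strongly_measurable_compose[OF t(1) f]
    by (intro conjI exI[of _ "\<lambda>i x. s i (t x)"]) auto
qed

text \<open>This is where completeness of the target enters: suitably truncated simple functions
  converge to \<open>f\<close> in mean by dominated convergence, so their integrals form a Cauchy
  sequence.\<close>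

lemma has_strong_integral_bounded_support:
  fixes f :: "'a \<Rightarrow> 'b::banach"
  assumes f: "strongly_measurable M f"
    and A: "A \<in> sets M" "emeasure M A < \<infinity>"
    and bound: "\<And>x. x \<in> space M \<Longrightarrow> norm (f x) \<le> C * indicat_real A x" and C: "0 < C"
  shows "has_strong_integral M f (strong_integral M f)"
proof -
  obtain s where s: "\<And>i. simple_function M (s i)" "\<And>x. x \<in> space M \<Longrightarrow> (\<lambda>i. s i x) \<longlonglongrightarrow> f x"
    using f unfolding strongly_measurable_def by metis
  \<comment> \<open>The indicator makes the support finite in measure. The threshold
    \<open>2 * C\<close> lies strictly above the bound \<open>C\<close> for \<open>f\<close>, so at
    each point of \<open>A\<close> the truncation is eventually inactive.\<close>
  define t where "t i x = indicat_real A x *\<^sub>R (if norm (s i x) \<le> 2 * C then s i x else 0)" for i x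
  have t: "simple_function M (t i)" for i
    unfolding t_def by (rule simple_function_compose2[of M "indicat_real A" "s i"
        "\<lambda>a b. a *\<^sub>R (if norm b \<le> 2 * C then b else 0)"]) (auto intro: A s)
  have t_int: "Bochner_Integration.simple_bochner_integrable M (t i)" for i
  proof
    have "emeasure M {x \<in> space M. t i x \<noteq> 0} \<le> emeasure M A"
      by (intro emeasure_mono A) (auto simp: t_def indicator_def split: if_splits)
    with A show "emeasure M {x \<in> space M. t i x \<noteq> 0} \<noteq> \<infinity>" by auto
  qed (rule t)
  have t_lim: "(\<lambda>i. t i x) \<longlonglongrightarrow> f x" if x: "x \<in> space M" for x
  proof (cases "x \<in> A")
    case True
    have "norm (f x) < 2 * C"
      using bound[OF x] C True by simp
    with tendsto_norm[OF s(2)[OF x]] have "\<forall>\<^sub>F i in sequentially. norm (s i x) < 2 * C"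
      by (rule order_tendstoD)
    then have "\<forall>\<^sub>F i in sequentially. s i x = t i x"
      by eventually_elim (simp add: t_def True)
    with s(2)[OF x] show ?thesis by (rule Lim_transform_eventually)
  next
    case False
    then have "f x = 0" using bound[OF x] by simp
    with False show ?thesis by (simp add: t_def)
  qed
  have m: "(\<lambda>x. norm (f x - t i x)) \<in> borel_measurable M" for i
    by (intro borel_measurable_norm_strongly_measurable strongly_measurable_diff
        strongly_measurable_simple_function f t)
  \<comment> \<open>On \<open>A\<close>, the function \<open>f\<close> contributes \<open>C\<close>
    and the truncated \<open>t i\<close> contributes \<open>2 * C\<close>.\<close>
  have "norm (f x - t i x) \<le> 3 * C * indicat_real A x" if x: "x \<in> space M" for x i
    using norm_triangle_ineq4[of "f x" "t i x"] bound[OF x] C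
    by (cases "x \<in> A") (auto simp: t_def split: if_splits)
  then have dom: "AE x in M. ennreal (norm (f x - t i x)) \<le> ennreal (3 * C) * indicator A x" for i
    by (intro AE_I2) (auto simp: ennreal_indicator[symmetric] ennreal_mult'[symmetric] C less_imp_le
        simp del: ennreal_indicator intro!: ennreal_leI)
  have "(\<lambda>i. \<integral>\<^sup>+x. norm (f x - t i x) \<partial>M) \<longlonglongrightarrow> (\<integral>\<^sup>+x. 0 \<partial>M)"
  proof (rule nn_integral_dominated_convergence[OF _ _ _ dom])
    show "(\<integral>\<^sup>+x. ennreal (3 * C) * indicator A x \<partial>M) < \<infinity>"
      using A by (simp add: nn_integral_cmult_indicator ennreal_mult_less_top)
    have "(\<lambda>i. ennreal (norm (f x - t i x))) \<longlonglongrightarrow> ennreal 0" if "x \<in> space M" for x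
      using tendsto_norm[OF tendsto_diff[OF tendsto_const t_lim[OF that], of "f x"]]
      by (intro tendsto_ennrealI) simp
    then show "AE x in M. (\<lambda>i. ennreal (norm (f x - t i x))) \<longlonglongrightarrow> 0"
      by (intro AE_I2) simp
  qed (use m A in auto)
  then have lim: "(\<lambda>i. \<integral>\<^sup>+x. norm (f x - t i x) \<partial>M) \<longlonglongrightarrow> 0" by simp
  let ?I = "\<lambda>i. Bochner_Integration.simple_bochner_integral M (t i)"
  have diff: "ennreal (norm (?I i - ?I j)) \<le>
      (\<integral>\<^sup>+x. norm (f x - t i x) \<partial>M) + (\<integral>\<^sup>+x. norm (f x - t j x) \<partial>M)" for i j
  proof -
    have "ennreal (norm (?I i - ?I j)) \<le> (\<integral>\<^sup>+x. norm (t i x - t j x) \<partial>M)"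
      using norm_simple_bochner_integral_le[OF simple_bochner_integrable_compose2[of "(-)",
            OF _ t_int[of i] t_int[of j]]]
      by (simp add: simple_bochner_integral_diff t_int)
    also have "\<dots> \<le> (\<integral>\<^sup>+x. ennreal (norm (f x - t i x)) + norm (f x - t j x) \<partial>M)"
    proof -
      have "norm (t i x - t j x) \<le> norm (f x - t i x) + norm (f x - t j x)" for x
        by (metis dual_order.refl norm_diff_triangle_le norm_minus_commute)
      then show ?thesis
        by (auto intro!: nn_integral_mono simp flip: ennreal_plus)
    qed
    also have "\<dots> = (\<integral>\<^sup>+x. norm (f x - t i x) \<partial>M) + (\<integral>\<^sup>+x. norm (f x - t j x) \<partial>M)"
      using m by (intro nn_integral_add) auto
    finally show ?thesis .
  qed
  have "Cauchy ?I"
  proof (rule metric_CauchyI)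
    fix e :: real assume e: "0 < e"
    then have "\<forall>\<^sub>F i in sequentially. (\<integral>\<^sup>+x. norm (f x - t i x) \<partial>M) < ennreal (e / 2)"
      by (intro order_tendstoD(2)[OF lim]) simp
    then obtain N where N: "\<And>i. i \<ge> N \<Longrightarrow> (\<integral>\<^sup>+x. norm (f x - t i x) \<partial>M) < ennreal (e / 2)"
      by (auto simp: eventually_sequentially)
    have "dist (?I i) (?I j) < e" if "i \<ge> N" "j \<ge> N" for i j
    proof -
      have "ennreal (norm (?I i - ?I j)) < ennreal (e / 2) + ennreal (e / 2)"
        using diff[of i j] add_strict_mono[OF N[OF that(1)] N[OF that(2)]] by (rule le_less_trans)
      also have "\<dots> = ennreal e"
        using e by (simp flip: ennreal_plus)
      finally show ?thesis
        by (simp add: dist_norm ennreal_less_iff)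
    qed
    then show "\<exists>N. \<forall>i\<ge>N. \<forall>j\<ge>N. dist (?I i) (?I j) < e" by blast
  qed
  then obtain I where "?I \<longlonglongrightarrow> I"
    using Cauchy_convergent_iff[of ?I] by (auto simp: convergent_def)
  with lim t_int f have "has_strong_integral M f I"
    unfolding has_strong_integral_def by blast
  then show ?thesis by (simp add: strong_integral_eqI)
qed

section \<open>Averages along an action on a group with invariant measure\<close>

text \<open>A common abstraction of counting measure and Haar measure, so that both kinds of groups
  share one argument about averages.\<close>

locale invariant_group_measure = group G for G :: "('g, 'm) monoid_scheme" (structure) +
  fixes \<mu> :: "'g measure"
  assumes space_eq: "space \<mu> = carrier G"
    and translation_measurable: "h \<in> carrier G \<Longrightarrow> (\<lambda>g. h \<otimes> g) \<in> measurable \<mu> \<mu>"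
    and inversion_measurable: "(\<lambda>g. inv g) \<in> measurable \<mu> \<mu>"
    and emeasure_l_coset: "h \<in> carrier G \<Longrightarrow> A \<in> sets \<mu> \<Longrightarrow> emeasure \<mu> (h <# A) = emeasure \<mu> A"
begin

lemma vimage_translation:
  assumes "h \<in> carrier G" "A \<subseteq> carrier G"
  shows "(\<lambda>g. h \<otimes> g) -` A \<inter> carrier G = inv h <# A"
proof (intro equalityI subsetI)
  fix g assume "g \<in> (\<lambda>g. h \<otimes> g) -` A \<inter> carrier G"
  then have "h \<otimes> g \<in> A" "g = inv h \<otimes> (h \<otimes> g)"
    using assms by (auto simp: m_assoc[symmetric])
  then show "g \<in> inv h <# A"
    unfolding l_coset_def by blast
next
  fix g assume "g \<in> inv h <# A"
  then show "g \<in> (\<lambda>g. h \<otimes> g) -` A \<inter> carrier G"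
    using assms by (auto simp: l_coset_def m_assoc[symmetric])
qed

lemma l_coset_measurable:
  assumes "h \<in> carrier G" "A \<in> sets \<mu>"
  shows "h <# A \<in> sets \<mu>"
  using measurable_sets[OF translation_measurable[of "inv h"], of A]
    vimage_translation[of "inv h" A] assms sets.sets_into_space[OF assms(2)]
  by (simp add: space_eq)

text \<open>Invariance of cosets becomes invariance of the image measure, the form that substitution
  in integrals uses: preimages under translation by \<open>h\<close> are cosets of
  \<open>inv h\<close>.\<close>

lemma distr_translation:
  assumes "h \<in> carrier G"
  shows "distr \<mu> \<mu> (\<lambda>g. h \<otimes> g) = \<mu>"
proof (rule measure_eqI)
  fix A assume "A \<in> sets (distr \<mu> \<mu> (\<lambda>g. h \<otimes> g))"
  then have A: "A \<in> sets \<mu>" by simp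
  then show "emeasure (distr \<mu> \<mu> (\<lambda>g. h \<otimes> g)) A = emeasure \<mu> A"
    using vimage_translation[OF assms, of A] sets.sets_into_space[OF A] emeasure_l_coset[of "inv h" A] assms
    by (simp add: emeasure_distr translation_measurable space_eq)
qed simp

end

section \<open>Averages of orbits over sets of positive measure\<close>

locale strong_action = invariant_group_measure +
  fixes \<pi> :: "'a \<Rightarrow> 'c::banach \<Rightarrow>\<^sub>L 'c"
  assumes acts: "acts_strongly G \<mu> \<pi>"
begin

lemma norm_action_le: "g \<in> carrier G \<Longrightarrow> norm (\<pi> g x) \<le> norm x"
  using norm_blinfun[of "\<pi> g" x] acts by (simp add: acts_strongly_def)

lemma action_mult: "g \<in> carrier G \<Longrightarrow> h \<in> carrier G \<Longrightarrow> \<pi> g (\<pi> h x) = \<pi> (g \<otimes> h) x"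
  using acts unfolding acts_strongly_def by (metis blinfun_apply_blinfun_compose)

lemma strongly_measurable_orbit: "strongly_measurable \<mu> (\<lambda>g. \<pi> (inv g) x)"
  using acts strongly_measurable_compose[OF inversion_measurable] unfolding acts_strongly_def by blast

text \<open>The body of \<open>ergodic_average\<close> for a single set, with the vector as last
  argument so that \<open>set_average A\<close> is an operator and averages can be composed.\<close>

definition set_average :: "'a set \<Rightarrow> 'c \<Rightarrow> 'c" where
  "set_average A x = (1 / measure \<mu> A) *\<^sub>R
    strong_integral \<mu> (\<lambda>g. indicat_real A g *\<^sub>R \<pi> (inv g) x)"

context
  fixes A :: "'a set"
  assumes A: "A \<in> sets \<mu>" "0 < measure \<mu> A"
begin

text \<open>Since \<open>measure\<close> is 0 on sets of infinite measure, its positivity already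
  contains finiteness.\<close>

lemma emeasure_eq: "emeasure \<mu> A = ennreal (measure \<mu> A)" and emeasure_finite: "emeasure \<mu> A < \<infinity>"
proof -
  show "emeasure \<mu> A = ennreal (measure \<mu> A)"
    using A by (intro emeasure_eq_ennreal_measure) (auto simp: measure_def)
  then show "emeasure \<mu> A < \<infinity>" by simp
qed

lemma norm_indicator_orbit_le:
  "g \<in> space \<mu> \<Longrightarrow> norm (indicat_real A g *\<^sub>R \<pi> (inv g) x) \<le> norm x * indicat_real A g"
  by (simp add: indicator_def norm_action_le space_eq)

lemma has_strong_integral_orbit:
  "has_strong_integral \<mu> (\<lambda>g. indicat_real A g *\<^sub>R \<pi> (inv g) x) (measure \<mu> A *\<^sub>R set_average A x)"
proof -
  \<comment> \<open>The existence lemma wants a positive constant; adding 1 covers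
    \<open>x = 0\<close>.\<close>
  have "norm (indicat_real A g *\<^sub>R \<pi> (inv g) x) \<le> (norm x + 1) * indicat_real A g"
    if "g \<in> space \<mu>" for g
    using norm_indicator_orbit_le[OF that, of x] by (cases "g \<in> A") auto
  then have "has_strong_integral \<mu> (\<lambda>g. indicat_real A g *\<^sub>R \<pi> (inv g) x)
      (strong_integral \<mu> (\<lambda>g. indicat_real A g *\<^sub>R \<pi> (inv g) x))"
    by (rule has_strong_integral_bounded_support[OF strongly_measurable_indicator_scaleR[OF A(1)
            strongly_measurable_orbit] A(1) emeasure_finite]) (auto simp: add_nonneg_pos)
  then show ?thesis
    using A(2) by (simp add: set_average_def)
qed

text \<open>Averages are identified through the undivided integral, so their linearity reduces to
  that of the integral.\<close>

lemma set_average_eqI: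
  assumes "has_strong_integral \<mu> (\<lambda>g. indicat_real A g *\<^sub>R \<pi> (inv g) x) (measure \<mu> A *\<^sub>R y)"
  shows "set_average A x = y"
  using has_strong_integral_unique[OF has_strong_integral_orbit assms] A(2) by simp

lemma norm_set_average_le: "norm (set_average A x) \<le> norm x"
proof -
  have "ennreal (norm (measure \<mu> A *\<^sub>R set_average A x)) \<le>
      (\<integral>\<^sup>+g. norm (indicat_real A g *\<^sub>R \<pi> (inv g) x) \<partial>\<mu>)"
    by (rule has_strong_integral_norm_bound[OF has_strong_integral_orbit])
  also have "\<dots> \<le> (\<integral>\<^sup>+g. ennreal (norm x) * indicator A g \<partial>\<mu>)"
    by (intro nn_integral_mono)
      (auto simp: indicator_def space_eq intro!: norm_action_le ennreal_leI)
  also have "\<dots> = ennreal (norm x * measure \<mu> A)"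
    using A by (simp add: nn_integral_cmult_indicator emeasure_eq ennreal_mult)
  finally have "measure \<mu> A * norm (set_average A x) \<le> measure \<mu> A * norm x"
    using A(2) by (simp add: ennreal_le_iff mult.commute)
  with A(2) show ?thesis by simp
qed

lemma bounded_linear_set_average: "bounded_linear (set_average A)"
proof
  fix x y :: 'c and c :: real
  show "set_average A (x + y) = set_average A x + set_average A y"
    using has_strong_integral_add[OF has_strong_integral_orbit[of x] has_strong_integral_orbit[of y]]
    by (intro set_average_eqI) (simp add: blinfun.add_right scaleR_add_right)
  show "set_average A (c *\<^sub>R x) = c *\<^sub>R set_average A x"
    using has_strong_integral_bounded_linear[OF bounded_linear_scaleR_right
        has_strong_integral_orbit[of x], of c]
    by (intro set_average_eqI) (simp add: blinfun.scaleR_right mult.commute)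
  show "\<exists>K. \<forall>x. norm (set_average A x) \<le> norm x * K"
    using norm_set_average_le by (intro exI[of _ 1]) simp
qed

text \<open>Substituting \<open>inv h \<otimes> g\<close> for \<open>g\<close> turns the integrand
  into \<open>\<pi> (inv g) x\<close>, because \<open>h\<close> and \<open>inv h\<close> cancel, and
  turns the domain \<open>A\<close> into \<open>h <# A\<close>. The two averages thus integrate the
  same orbit and differ only on the symmetric difference, where the integrand has norm at most
  \<open>norm x\<close>.\<close>

lemma norm_set_average_translate_le:
  assumes h: "h \<in> carrier G"
  shows "norm (set_average A (\<pi> (inv h) x) - set_average A x) \<le>
    measure \<mu> (sym_diff A (h <# A)) / measure \<mu> A * norm x"
proof -
  have hA: "h <# A \<in> sets \<mu>" "emeasure \<mu> (h <# A) = emeasure \<mu> A"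
    using l_coset_measurable[OF h A(1)] emeasure_l_coset[OF h A(1)] .
  have sub: "A \<subseteq> carrier G"
    using sets.sets_into_space[OF A(1)] by (simp add: space_eq)
  have inv_vimage: "inv h \<otimes> g \<in> A \<longleftrightarrow> g \<in> h <# A" if "g \<in> carrier G" for g
    using vimage_translation[of "inv h" A] sub that h by (auto simp: set_eq_iff)
  have "has_strong_integral \<mu> (\<lambda>g. indicat_real A (inv h \<otimes> g) *\<^sub>R
      \<pi> (inv (inv h \<otimes> g)) (\<pi> (inv h) x)) (measure \<mu> A *\<^sub>R set_average A (\<pi> (inv h) x))"
    by (rule has_strong_integral_measure_preserving[OF translation_measurable distr_translation
        has_strong_integral_orbit]) (use h in auto)
  then have "has_strong_integral \<mu> (\<lambda>g. indicat_real (h <# A) g *\<^sub>R \<pi> (inv g) x)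
      (measure \<mu> A *\<^sub>R set_average A (\<pi> (inv h) x))"
    by (rule iffD1[OF has_strong_integral_cong, rotated])
      (use h in \<open>auto simp: space_eq indicator_def inv_vimage action_mult inv_mult_group m_assoc\<close>)
  from has_strong_integral_diff[OF this has_strong_integral_orbit[of x]]
  have "has_strong_integral \<mu> (\<lambda>g. (indicat_real (h <# A) g - indicat_real A g) *\<^sub>R \<pi> (inv g) x)
      (measure \<mu> A *\<^sub>R (set_average A (\<pi> (inv h) x) - set_average A x))"
    by (simp add: algebra_simps)
  then have "ennreal (norm (measure \<mu> A *\<^sub>R (set_average A (\<pi> (inv h) x) - set_average A x))) \<le>
      (\<integral>\<^sup>+g. norm ((indicat_real (h <# A) g - indicat_real A g) *\<^sub>R \<pi> (inv g) x) \<partial>\<mu>)"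
    by (rule has_strong_integral_norm_bound)
  also have "\<dots> \<le> (\<integral>\<^sup>+g. ennreal (norm x) * indicator (sym_diff A (h <# A)) g \<partial>\<mu>)"
    by (intro nn_integral_mono)
      (auto simp: indicator_def space_eq intro!: norm_action_le ennreal_leI)
  also have "\<dots> = ennreal (norm x) * emeasure \<mu> (sym_diff A (h <# A))"
    using A hA by (intro nn_integral_cmult_indicator) auto
  also have "emeasure \<mu> (sym_diff A (h <# A)) = ennreal (measure \<mu> (sym_diff A (h <# A)))"
  proof -
    have "emeasure \<mu> (sym_diff A (h <# A)) \<le> emeasure \<mu> (A \<union> (h <# A))"
      using A hA by (intro emeasure_mono) auto
    also have "\<dots> \<le> emeasure \<mu> A + emeasure \<mu> (h <# A)"
      using A hA by (intro emeasure_subadditive) auto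
    also have "\<dots> < \<infinity>"
      using emeasure_finite hA by simp
    finally show ?thesis
      by (intro emeasure_eq_ennreal_measure) auto
  qed
  finally have "measure \<mu> A * norm (set_average A (\<pi> (inv h) x) - set_average A x) \<le>
      norm x * measure \<mu> (sym_diff A (h <# A))"
    by (simp add: ennreal_mult[symmetric] ennreal_le_iff)
  with A(2) show ?thesis
    by (simp add: field_simps)
qed

end

text \<open>The set \<open>B'\<close> of almost invariant translations contributes
  \<open>\<delta>\<close>. The rest has relative measure at most \<open>\<delta>\<close> and is
  bounded trivially by twice the norm, contributing \<open>2 * \<delta>\<close>; hence the factor
  3.\<close>

lemma norm_set_average_set_average_le:
  assumes A: "A \<in> sets \<mu>" "0 < measure \<mu> A" and B: "B \<in> sets \<mu>" "0 < measure \<mu> B"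
    and B': "B' \<in> sets \<mu>" "B' \<subseteq> B" "measure \<mu> (B - B') \<le> \<delta> * measure \<mu> B"
    and inv: "\<And>h. h \<in> B' \<Longrightarrow> measure \<mu> (sym_diff A (h <# A)) / measure \<mu> A \<le> \<delta>"
    and \<delta>: "0 \<le> \<delta>"
  shows "norm (set_average A (set_average B x) - set_average A x) \<le> 3 * \<delta> * norm x"
proof -
  interpret T: bounded_linear "set_average A" by (rule bounded_linear_set_average[OF A])
  \<comment> \<open>The constant vector \<open>set_average A x\<close> is written as an integral
    over \<open>B\<close> too: the real indicator is integrated first and then multiplied by the
    vector.\<close>
  have "has_strong_integral \<mu> (indicat_real B) (measure \<mu> B)"
    using B emeasure_finite[OF B]
    by (simp add: has_strong_integral_iff_has_bochner_integral has_bochner_integral_real_indicator)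
  from has_strong_integral_diff[OF has_strong_integral_bounded_linear[OF T.bounded_linear_axioms
        has_strong_integral_orbit[OF B, of x]]
      has_strong_integral_bounded_linear[OF bounded_linear_scaleR_left this, of "set_average A x"]]
  have int: "has_strong_integral \<mu>
      (\<lambda>g. indicat_real B g *\<^sub>R (set_average A (\<pi> (inv g) x) - set_average A x))
      (measure \<mu> B *\<^sub>R (set_average A (set_average B x) - set_average A x))"
    by (simp add: T.scaleR scaleR_diff_right)
  have ptw: "norm (indicat_real B g *\<^sub>R (set_average A (\<pi> (inv g) x) - set_average A x)) \<le>
      \<delta> * norm x * indicat_real B' g + 2 * norm x * indicat_real (B - B') g"
    if g: "g \<in> space \<mu>" for g
  proof (cases "g \<in> B'")
    case True
    have "norm (set_average A (\<pi> (inv g) x) - set_average A x) \<le>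
        measure \<mu> (sym_diff A (g <# A)) / measure \<mu> A * norm x"
      using g by (intro norm_set_average_translate_le A) (simp add: space_eq)
    also have "\<dots> \<le> \<delta> * norm x"
      by (intro mult_right_mono inv True) simp
    finally show ?thesis
      using True B'(2) by auto
  next
    case False
    have "norm (set_average A (\<pi> (inv g) x) - set_average A x) \<le>
        norm (set_average A (\<pi> (inv g) x)) + norm (set_average A x)"
      by (rule norm_triangle_ineq4)
    also have "\<dots> \<le> norm (\<pi> (inv g) x) + norm x"
      by (intro add_mono norm_set_average_le A)
    also have "\<dots> \<le> 2 * norm x"
      using norm_action_le[of "inv g" x] g by (simp add: space_eq)
    finally show ?thesis
      using False by (simp add: indicator_def)
  qed
  have fin: "emeasure \<mu> C = ennreal (measure \<mu> C)" if "C \<subseteq> B" for C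
    using emeasure_mono[OF that B(1)] emeasure_finite[OF B]
    by (intro emeasure_eq_ennreal_measure) (auto simp: top_unique)
  have "ennreal (norm (measure \<mu> B *\<^sub>R (set_average A (set_average B x) - set_average A x))) \<le>
      (\<integral>\<^sup>+g. norm (indicat_real B g *\<^sub>R (set_average A (\<pi> (inv g) x) - set_average A x)) \<partial>\<mu>)"
    by (rule has_strong_integral_norm_bound[OF int])
  also have "\<dots> \<le> (\<integral>\<^sup>+g. ennreal (\<delta> * norm x) * indicator B' g +
      ennreal (2 * norm x) * indicator (B - B') g \<partial>\<mu>)"
  proof (intro nn_integral_mono)
    fix g assume "g \<in> space \<mu>"
    from ennreal_leI[OF ptw[OF this]] \<delta>
    show "ennreal (norm (indicat_real B g *\<^sub>R (set_average A (\<pi> (inv g) x) - set_average A x))) \<le>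
        ennreal (\<delta> * norm x) * indicator B' g + ennreal (2 * norm x) * indicator (B - B') g"
      by (auto simp: indicator_def split: if_splits)
  qed
  also have "\<dots> = ennreal (\<delta> * norm x) * emeasure \<mu> B' + ennreal (2 * norm x) * emeasure \<mu> (B - B')"
    using B B' by (subst nn_integral_add) (auto simp: nn_integral_cmult_indicator)
  also have "\<dots> = ennreal (\<delta> * norm x * measure \<mu> B' + 2 * norm x * measure \<mu> (B - B'))"
    using B' \<delta> by (simp add: fin ennreal_mult'[symmetric] flip: ennreal_plus)
  finally have "measure \<mu> B * norm (set_average A (set_average B x) - set_average A x) \<le>
      \<delta> * norm x * measure \<mu> B' + 2 * norm x * measure \<mu> (B - B')"
    using \<delta> by (simp add: ennreal_le_iff del: ennreal_plus)
  also have "\<dots> \<le> \<delta> * norm x * measure \<mu> B + 2 * norm x * (\<delta> * measure \<mu> B)"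
  proof (intro add_mono mult_left_mono B')
    show "measure \<mu> B' \<le> measure \<mu> B"
      using B B' emeasure_finite[OF B] by (intro measure_mono_fmeasurable) (auto simp: fmeasurable_def)
  qed (use \<delta> in auto)
  also have "\<dots> = measure \<mu> B * (3 * \<delta> * norm x)"
    by (simp add: algebra_simps)
  finally show ?thesis
    using B(2) by simp
qed

end

section \<open>Counting measure and left Haar measure as invariant measures\<close>

lemma (in group) l_coset_eq_image: "h <# A = (\<lambda>g. h \<otimes> g) ` A"
  by (auto simp: l_coset_def)

lemma invariant_group_measure_count_space:
  assumes "group G"
  shows "invariant_group_measure G (count_space (carrier G))"
proof -
  interpret group G by fact
  show ?thesis
  proof
    fix h A assume h: "h \<in> carrier G" and A: "A \<in> sets (count_space (carrier G))"
    then have sub: "A \<subseteq> carrier G" by simp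
    \<comment> \<open>By cancellation a translate has as many elements as the set itself, and is
      infinite exactly when the set is.\<close>
    then have inj: "inj_on (\<lambda>g. h \<otimes>\<^bsub>G\<^esub> g) A"
      using h by (intro inj_onI) (metis Units_eq Units_l_cancel subsetD)
    moreover have "(\<lambda>g. h \<otimes>\<^bsub>G\<^esub> g) ` A \<subseteq> carrier G"
      using h sub by auto
    ultimately show "emeasure (count_space (carrier G)) (h <#\<^bsub>G\<^esub> A) = emeasure (count_space (carrier G)) A"
      using sub by (simp add: l_coset_eq_image emeasure_count_space finite_image_iff card_image)
  qed auto
qed

lemma sets_left_haar_measure:
  assumes "left_haar_measure G T \<mu>"
  shows "sets \<mu> = sigma_sets (topspace T) {U. openin T U}" "space \<mu> = topspace T"
proof -
  have *: "sets \<mu> = sets (sigma (topspace T) {U. openin T U})"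
    using assms by (simp add: left_haar_measure_def)
  have sub: "{U. openin T U} \<subseteq> Pow (topspace T)"
    by (auto dest: openin_subset)
  show "sets \<mu> = sigma_sets (topspace T) {U. openin T U}" "space \<mu> = topspace T"
    using * sets_eq_imp_space_eq[OF *] by (simp_all add: sets_measure_of[OF sub] space_measure_of[OF sub])
qed

text \<open>Measurability can be tested on open sets, which generate the sigma-algebra.\<close>

lemma continuous_map_measurable_left_haar:
  assumes \<mu>: "left_haar_measure G T \<mu>" and f: "continuous_map T T f"
  shows "f \<in> measurable \<mu> \<mu>"
proof (rule measurable_sigma_sets)
  show "sets \<mu> = sigma_sets (topspace T) {U. openin T U}"
    by (rule sets_left_haar_measure[OF \<mu>])
  show "{U. openin T U} \<subseteq> Pow (topspace T)"
    by (auto dest: openin_subset)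
  show "f \<in> space \<mu> \<rightarrow> topspace T"
    using f by (simp add: sets_left_haar_measure[OF \<mu>] continuous_map_def)
  fix U assume "U \<in> {U. openin T U}"
  then have "openin T {x \<in> topspace T. f x \<in> U}"
    using f by (simp add: continuous_map_def)
  moreover have "f -` U \<inter> space \<mu> = {x \<in> topspace T. f x \<in> U}"
    by (auto simp: sets_left_haar_measure[OF \<mu>])
  ultimately show "f -` U \<inter> space \<mu> \<in> sets \<mu>"
    by (simp add: sets_left_haar_measure[OF \<mu>] sigma_sets.Basic)
qed

text \<open>Compact sets in a Hausdorff space are closed, so they are complements of
  generators.\<close>

lemma compactin_sets_left_haar_measure:
  assumes \<mu>: "left_haar_measure G T \<mu>" and T: "Hausdorff_space T" and K: "compactin T K"
  shows "K \<in> sets \<mu>"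
proof -
  have "closedin T K"
    using compactin_imp_closedin[OF T K] .
  then have "K = topspace T - (topspace T - K)" "openin T (topspace T - K)"
    by (auto simp: closedin_def)
  then show ?thesis
    unfolding sets_left_haar_measure[OF \<mu>]
    by (metis (mono_tags) mem_Collect_eq sigma_sets.Basic sigma_sets.Compl)
qed

lemma invariant_group_measure_left_haar:
  assumes G: "lcsc_group G T" and \<mu>: "left_haar_measure G T \<mu>"
  shows "invariant_group_measure G \<mu>"
proof -
  interpret group G using G by (simp add: lcsc_group_def)
  have top: "topspace T = carrier G"
    and mult: "continuous_map (prod_topology T T) T (\<lambda>(g, h). g \<otimes>\<^bsub>G\<^esub> h)"
    and inv: "continuous_map T T (\<lambda>g. inv\<^bsub>G\<^esub> g)"
    using G by (simp_all add: lcsc_group_def)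
  show ?thesis
  proof
    show "space \<mu> = carrier G"
      by (simp add: sets_left_haar_measure[OF \<mu>] top)
    show "(\<lambda>g. inv\<^bsub>G\<^esub> g) \<in> measurable \<mu> \<mu>"
      by (rule continuous_map_measurable_left_haar[OF \<mu> inv])
  next
    fix h assume h: "h \<in> carrier G"
    \<comment> \<open>Left translation is joint multiplication restricted to the slice with first
      coordinate \<open>h\<close>.\<close>
    have "continuous_map T (prod_topology T T) (\<lambda>g. (h, g))"
      using h by (auto simp: continuous_map_pairwise o_def top)
    from continuous_map_compose[OF this mult]
    show "(\<lambda>g. h \<otimes>\<^bsub>G\<^esub> g) \<in> measurable \<mu> \<mu>"
      by (intro continuous_map_measurable_left_haar[OF \<mu>]) (simp add: o_def)
  next
    fix h A assume "h \<in> carrier G" "A \<in> sets \<mu>"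
    then show "emeasure \<mu> (h <#\<^bsub>G\<^esub> A) = emeasure \<mu> A"
      using \<mu> by (simp add: left_haar_measure_def)
  qed
qed

text \<open>The whole \<open>F k\<close> serves as the good subset. Nothing is left out, and the
  strict bound on the omitted part holds because \<open>\<delta>\<close> and the size of
  \<open>F k\<close> are positive.\<close>

lemma fast_discrete_imp_fast_lcsc:
  assumes F: "\<And>n. finite (F n) \<and> F n \<noteq> {} \<and> F n \<subseteq> carrier G"
    and G: "group G" and fast: "fast_discrete G l \<delta> F" and \<delta>: "0 < \<delta>"
  shows "fast_lcsc G (count_space (carrier G)) l \<delta> F"
proof -
  interpret group G by fact
  have meas: "measure (count_space (carrier G)) C = real (card C)" if "C \<subseteq> carrier G" "finite C" for C
    using that by (simp add: measure_count_space)
  show ?thesis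
    unfolding fast_lcsc_def
  proof (intro allI impI)
    fix k m assume m: "k + l \<le> m"
    have "measure (count_space (carrier G)) (sym_diff (F m) (g <#\<^bsub>G\<^esub> F m)) /
        measure (count_space (carrier G)) (F m) < \<delta>" if g: "g \<in> F k" for g
    proof -
      have "g <#\<^bsub>G\<^esub> F m \<subseteq> carrier G" "finite (g <#\<^bsub>G\<^esub> F m)"
        using F[of k] F[of m] g by (auto simp: l_coset_eq_image)
      then have "measure (count_space (carrier G)) (sym_diff (F m) (g <#\<^bsub>G\<^esub> F m)) =
          real (card (sym_diff (F m) (g <#\<^bsub>G\<^esub> F m)))"
        using F[of m] by (intro meas) auto
      moreover have "measure (count_space (carrier G)) (F m) = real (card (F m))"
        using F[of m] by (intro meas) auto
      ultimately show ?thesis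
        using fast m g by (simp add: fast_discrete_def)
    qed
    moreover have "0 < \<delta> * measure (count_space (carrier G)) (F k)"
      using F[of k] \<delta> meas[of "F k"] by (simp add: card_gt_0_iff)
    ultimately show "\<exists>F'\<in>sets (count_space (carrier G)). F' \<subseteq> F k \<and>
        measure (count_space (carrier G)) (F k - F') < \<delta> * measure (count_space (carrier G)) (F k) \<and>
        (\<forall>g\<in>F'. measure (count_space (carrier G)) (sym_diff (F m) (g <#\<^bsub>G\<^esub> F m)) /
          measure (count_space (carrier G)) (F m) < \<delta>)"
      using F[of k] by (intro bexI[of _ "F k"]) auto
  qed
qed

section \<open>Counting fluctuations\<close>

text \<open>The modulus is defined for pairs ordered by norm; the maximum absorbs the choice of
  order.\<close>

lemma modulus_of_uniform_convexity_midpoint: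
  fixes x y :: "'b::real_normed_vector"
  assumes u: "modulus_of_uniform_convexity TYPE('b) u" and "0 < \<epsilon>"
    and "norm x \<le> 1" "norm y \<le> 1" "\<epsilon> \<le> norm (x - y)"
  shows "norm ((1/2) *\<^sub>R (x + y)) < max (norm x) (norm y) - u \<epsilon>"
proof -
  have *: "norm ((1/2) *\<^sub>R (v + w)) < norm w - u \<epsilon>"
    if "norm v \<le> norm w" "norm w \<le> 1" "\<epsilon> \<le> norm (v - w)" for v w :: 'b
    using u \<open>0 < \<epsilon>\<close> that unfolding modulus_of_uniform_convexity_def by blast
  show ?thesis
  proof (cases "norm x \<le> norm y")
    case True
    then show ?thesis using *[of x y] assms by simp
  next
    case False
    then show ?thesis using *[of y x] assms by (simp add: add.commute norm_minus_commute)
  qed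
qed

text \<open>Converts a number of fluctuations into a distance between indices, as the delay
  \<open>l\<close> requires.\<close>

lemma strict_mono_on_gap:
  fixes n :: "nat \<Rightarrow> nat"
  assumes n: "strict_mono_on {0..k} n" and "i + d \<le> k"
  shows "n i + d \<le> n (i + d)"
  using assms(2)
proof (induction d)
  case (Suc d)
  then have "n (i + d) < n (i + Suc d)"
    by (intro strict_mono_onD[OF n]) auto
  with Suc show ?case by simp
qed simp

text \<open>Separates counting from integration: the averages enter through linearity, contractivity
  and the approximate absorption \<open>A m (X k) \<approx> X m\<close>.\<close>

lemma at_most_fluctuations_almost_averages:
  fixes X :: "nat \<Rightarrow> 'b::real_normed_vector"
  assumes u: "modulus_of_uniform_convexity TYPE('b) u" and \<epsilon>: "0 < \<epsilon>"
    and r: "r \<le> 1" "\<And>n. norm (X n) \<le> r"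
    and lin: "\<And>m. linear (A m)" and contr: "\<And>m y. norm (A m y) \<le> norm y"
    and close: "\<And>k m. k + l \<le> m \<Longrightarrow> norm (A m (X k) - X m) \<le> \<eta>"
    and \<eta>: "0 \<le> \<eta>" "\<eta> < u \<epsilon> / 2" and l: "1 \<le> l"
  shows "at_most_fluctuations (l * nat \<lfloor>2 * r / (u \<epsilon> - 2 * \<eta>)\<rfloor> + l) \<epsilon> X"
proof -
  have drop: "norm (X m) < max (norm (X p)) (norm (X q)) - (u \<epsilon> - \<eta>)"
    if pq: "p \<le> q" "q + l \<le> m" "\<epsilon> \<le> norm (X p - X q)" for p q m
  proof -
    \<comment> \<open>The two absorption errors are averaged rather than added, so the total loss is
      \<open>\<eta>\<close> and not \<open>2 * \<eta>\<close>.\<close>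
    have *: "X m = A m ((1/2) *\<^sub>R (X p + X q)) -
        ((1/2) *\<^sub>R (A m (X p) - X m) + (1/2) *\<^sub>R (A m (X q) - X m))"
      by (simp add: linear_add[OF lin] linear_scale[OF lin] algebra_simps flip: scaleR_add_left)
    have "norm (X m) \<le> norm (A m ((1/2) *\<^sub>R (X p + X q))) +
        norm ((1/2) *\<^sub>R (A m (X p) - X m) + (1/2) *\<^sub>R (A m (X q) - X m))"
      by (subst *) (rule norm_triangle_ineq4)
    also have "\<dots> \<le> norm ((1/2) *\<^sub>R (X p + X q)) +
        (norm ((1/2) *\<^sub>R (A m (X p) - X m)) + norm ((1/2) *\<^sub>R (A m (X q) - X m)))"
      by (intro add_mono contr norm_triangle_ineq)
    also have "\<dots> \<le> norm ((1/2) *\<^sub>R (X p + X q)) + \<eta>"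
      using close[of p m] close[of q m] pq by simp
    also have "\<dots> < max (norm (X p)) (norm (X q)) - (u \<epsilon> - \<eta>)"
      using modulus_of_uniform_convexity_midpoint[OF u \<epsilon> _ _ pq(3)] r(2)[of p] r(2)[of q] r(1)
      by simp
    finally show ?thesis .
  qed
  show ?thesis
    unfolding at_most_fluctuations_def
  proof (intro allI impI, elim conjE)
    fix k and n :: "nat \<Rightarrow> nat"
    assume n: "strict_mono_on {0..k} n"
      and fluct: "\<forall>i<k. \<epsilon> \<le> norm (X (n i) - X (n (Suc i)))"
    \<comment> \<open>A block takes \<open>l + 1\<close> steps: one for the fluctuation from
      \<open>p\<close> to \<open>Suc p\<close>, and \<open>l\<close> more until \<open>drop\<close>
      applies. The index \<open>j\<close> stays arbitrary since the hypothesis is used at both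
      \<open>p\<close> and \<open>Suc p\<close>.\<close>
    have decay: "norm (X (n j)) \<le> r - real i * (u \<epsilon> - \<eta>)" if "(l + 1) * i \<le> j" "j \<le> k" for i j
      using that
    proof (induction i arbitrary: j)
      case (Suc i)
      define p where "p = (l + 1) * i"
      have pj: "Suc p + l \<le> j"
        using Suc.prems by (simp add: p_def)
      have "n p + 1 \<le> n (p + 1)"
        using pj Suc.prems by (intro strict_mono_on_gap[OF n]) simp
      moreover have "n (Suc p) + l \<le> n j"
        using strict_mono_on_gap[OF n, of "Suc p" "j - Suc p"] pj Suc.prems by simp
      ultimately have "norm (X (n j)) < max (norm (X (n p))) (norm (X (n (Suc p)))) - (u \<epsilon> - \<eta>)"
        using fluct pj Suc.prems by (intro drop) auto
      moreover have "norm (X (n p)) \<le> r - real i * (u \<epsilon> - \<eta>)"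
        "norm (X (n (Suc p))) \<le> r - real i * (u \<epsilon> - \<eta>)"
        using pj Suc.prems by (auto intro!: Suc.IH simp: p_def)
      ultimately show ?case
        by (simp add: algebra_simps)
    qed (use r in simp)
    \<comment> \<open>The number of complete blocks. Since the norm at the last index
      \<open>k\<close> is nonnegative, the total decay over these blocks is at most
      \<open>r\<close>.\<close>
    define i where "i = k div (l + 1)"
    have "real i * (u \<epsilon> - 2 * \<eta>) \<le> real i * (u \<epsilon> - \<eta>)"
      using \<eta> by (intro mult_left_mono) auto
    also have "\<dots> \<le> r"
      using order_trans[OF norm_ge_zero decay[OF times_div_less_eq_dividend, of k]] by (simp add: i_def)
    finally have "real (2 * i) \<le> 2 * r / (u \<epsilon> - 2 * \<eta>)"
      using \<eta> by (simp add: field_simps)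
    then have "2 * i \<le> nat \<lfloor>2 * r / (u \<epsilon> - 2 * \<eta>)\<rfloor>"
      by (simp add: le_nat_floor)
    then have "l * (2 * i) \<le> l * nat \<lfloor>2 * r / (u \<epsilon> - 2 * \<eta>)\<rfloor>"
      by (rule mult_le_mono2)
    \<comment> \<open>The block length \<open>l + 1\<close> is at most \<open>2 * l\<close>; this is
      what the factor 2 in the numerator of the bound pays for.\<close>
    moreover have "(l + 1) * i \<le> l * (2 * i)"
      using l by (cases l) auto
    \<comment> \<open>An incomplete last block holds at most \<open>l\<close> fluctuations, the
      additive term of the bound.\<close>
    moreover have "k \<le> (l + 1) * i + l"
    proof -
      have "k mod (l + 1) < l + 1" by simp
      then show ?thesis
        using mult_div_mod_eq[of "l + 1" k] unfolding i_def by linarith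
    qed
    ultimately show "k \<le> l * nat \<lfloor>2 * r / (u \<epsilon> - 2 * \<eta>)\<rfloor> + l"
      by linarith
  qed
qed

theorem corollary40:
  fixes u :: "real \<Rightarrow> real" and \<epsilon> \<eta> :: real and x :: "'b::banach" and l :: nat
    and G :: "('g, 'm) monoid_scheme" and T :: "'g topology" and \<mu> :: "'g measure"
    and \<pi> :: "'g \<Rightarrow> 'b \<Rightarrow>\<^sub>L 'b" and F :: "nat \<Rightarrow> 'g set"
  assumes "modulus_of_uniform_convexity TYPE('b) u"
    and "\<epsilon> > 0"
    and "x \<noteq> 0" and "norm x \<le> 1"
    and "0 < \<eta>" and "\<eta> < u \<epsilon> / 2"
    and "l \<ge> 1"
    and "(countable_discrete_group G T \<and> \<mu> = count_space (carrier G) \<and> amenable_discrete G \<and>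
          folner_discrete G F \<and> fast_discrete G l (\<eta> / (3 * norm x)) F) \<or>
         (lcsc_group G T \<and> left_haar_measure G T \<mu> \<and> amenable_lcsc G T \<mu> \<and>
          folner_lcsc G T \<mu> F \<and> fast_lcsc G \<mu> l (\<eta> / (3 * norm x)) F)"
    and "acts_strongly G \<mu> \<pi>"
  shows "at_most_fluctuations (l * nat \<lfloor>2 * norm x / (u \<epsilon> - 2 * \<eta>)\<rfloor> + l) \<epsilon>
           (\<lambda>n. ergodic_average G \<mu> \<pi> F n x)"
proof -
  let ?\<delta> = "\<eta> / (3 * norm x)"
  \<comment> \<open>The speed is chosen so that the \<open>3 * \<delta>\<close> estimate for
    composed averages becomes exactly \<open>\<eta>\<close>.\<close>
  have \<delta>: "0 < ?\<delta>" "3 * ?\<delta> * norm x = \<eta>"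
    using assms by simp_all
  \<comment> \<open>Both kinds of groups are reduced to this common form, after which the case
    distinction disappears.\<close>
  have "invariant_group_measure G \<mu> \<and> fast_lcsc G \<mu> l ?\<delta> F \<and> (\<forall>n. F n \<in> sets \<mu> \<and> 0 < measure \<mu> (F n))"
    using assms(8)
  proof (elim disjE conjE)
    assume G: "countable_discrete_group G T" and \<mu>: "\<mu> = count_space (carrier G)"
      and fol: "folner_discrete G F" and fast: "fast_discrete G l ?\<delta> F"
    have "group G"
      using G by (simp add: countable_discrete_group_def)
    moreover have F: "finite (F n) \<and> F n \<noteq> {} \<and> F n \<subseteq> carrier G" for n
      using fol by (simp add: folner_discrete_def)
    moreover have "0 < measure \<mu> (F n)" for n
      using F[of n] by (simp add: \<mu> measure_count_space card_gt_0_iff)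
    ultimately show ?thesis
      using fast_discrete_imp_fast_lcsc[OF F _ fast \<delta>(1)] invariant_group_measure_count_space
      by (simp add: \<mu>)
  next
    assume G: "lcsc_group G T" and \<mu>: "left_haar_measure G T \<mu>"
      and fol: "folner_lcsc G T \<mu> F" and fast: "fast_lcsc G \<mu> l ?\<delta> F"
    have "F n \<in> sets \<mu>" "0 < measure \<mu> (F n)" for n
      using fol G compactin_sets_left_haar_measure[OF \<mu>]
      by (simp_all add: folner_lcsc_def lcsc_group_def)
    then show ?thesis
      using fast invariant_group_measure_left_haar[OF G \<mu>] by simp
  qed
  then have inv: "invariant_group_measure G \<mu>" and fast: "fast_lcsc G \<mu> l ?\<delta> F"
    and F: "\<And>n. F n \<in> sets \<mu>" "\<And>n. 0 < measure \<mu> (F n)" by auto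
  interpret strong_action G \<mu> \<pi>
    using inv assms(9) by (simp add: strong_action_def strong_action_axioms_def)
  have "norm (set_average (F m) (set_average (F k) x) - set_average (F m) x) \<le> \<eta>"
    if km: "k + l \<le> m" for k m
  proof -
    obtain B where B: "B \<in> sets \<mu>" "B \<subseteq> F k" "measure \<mu> (F k - B) < ?\<delta> * measure \<mu> (F k)"
      and inv: "\<And>g. g \<in> B \<Longrightarrow> measure \<mu> (sym_diff (F m) (g <#\<^bsub>G\<^esub> F m)) / measure \<mu> (F m) < ?\<delta>"
      using fast[unfolded fast_lcsc_def, rule_format, OF km] by blast
    have "norm (set_average (F m) (set_average (F k) x) - set_average (F m) x) \<le> 3 * ?\<delta> * norm x"
      using B \<delta>(1)
      by (intro norm_set_average_set_average_le[where B' = B] F less_imp_le[OF inv]) auto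
    then show ?thesis by (simp only: \<delta>(2))
  qed
  then have "at_most_fluctuations (l * nat \<lfloor>2 * norm x / (u \<epsilon> - 2 * \<eta>)\<rfloor> + l) \<epsilon>
      (\<lambda>n. set_average (F n) x)"
    using assms(4-7)
    \<comment> \<open>Here \<open>r\<close> is \<open>norm x\<close>, which bounds every average
      since averaging is a contraction.\<close>
    by (intro at_most_fluctuations_almost_averages[OF assms(1,2), where A="\<lambda>m. set_average (F m)"]
        norm_set_average_le F bounded_linear.linear[OF bounded_linear_set_average]) auto
  then show ?thesis
    by (simp add: set_average_def ergodic_average_def)
qed

end
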